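(* Let $r\ge 3$ and $t\ge 2r$ be integers, and let $N=(\lfloor t/r\rfloor -1)^r$. Then there exist matchings $M_1,\dots,M_N$ of size $t$ in some $r$-partite $r$-uniform hypergraph with $tr$ vertices such that $M_1,\dots,M_N$ do not have a rainbow matching of size $t$, i.e., there are no distinct indices $i_1,\dots,i_t\in\{1,\dots,N\}$ and pairwise disjoint edges $e_1\in M_{i_1},\dots,e_t\in M_{i_t}$.
   Context: An $r$-uniform hypergraph is a hypergraph all of whose edges have exactly $r$ vertices; it is $r$-partite if its vertex set can be partitioned into $r$ parts such that every edge contains exactly one vertex from each part. A matching is a collection of pairwise disjoint edges; its size is the number of edges. *)

theory Defs
  imports Main "HOL-Library.Disjoint_Sets"
begin

definition hypergraph :: "'a set \<Rightarrow> 'a set set \<Rightarrow> bool" where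
  "hypergraph V E \<longleftrightarrow> finite V \<and> (\<forall>e\<in>E. e \<subseteq> V)"

definition uniform :: "nat \<Rightarrow> 'a set set \<Rightarrow> bool" where
  "uniform r E \<longleftrightarrow> (\<forall>e\<in>E. card e = r)"

text \<open>The parts are an indexed family, so empty parts are allowed; they cannot occur as soon
  as there is an edge.\<close>

definition partite :: "nat \<Rightarrow> 'a set \<Rightarrow> 'a set set \<Rightarrow> bool" where
  "partite r V E \<longleftrightarrow>
    (\<exists>P :: nat \<Rightarrow> 'a set.
       disjoint_family_on P {1..r} \<and> (\<Union>i\<in>{1..r}. P i) = V \<and>
       (\<forall>e\<in>E. \<forall>i\<in>{1..r}. card (e \<inter> P i) = 1))"

definition matching :: "'a set set \<Rightarrow> 'a set set \<Rightarrow> bool" where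
  "matching E M \<longleftrightarrow> M \<subseteq> E \<and> disjoint M"

text \<open>The family \<open>M\<close> is indexed by \<open>{1..N}\<close> and may contain repetitions: it is the indices
  chosen by \<open>i\<close> that have to be distinct. The edges \<open>e k\<close> are distinct as well when they are
  nonempty, because they are pairwise disjoint.\<close>

definition has_rainbow_matching :: "nat \<Rightarrow> (nat \<Rightarrow> 'a set set) \<Rightarrow> nat \<Rightarrow> bool" where
  "has_rainbow_matching N M t \<longleftrightarrow>
    (\<exists>(i :: nat \<Rightarrow> nat) (e :: nat \<Rightarrow> 'a set).
       inj_on i {1..t} \<and> i ` {1..t} \<subseteq> {1..N} \<and>
       (\<forall>k\<in>{1..t}. e k \<in> M (i k)) \<and> disjoint_family_on e {1..t})"

end

theory Submission
  imports Defs "HOL-Library.FuncSet"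
begin

text \<open>
  A vertex is a slot \<open>q < t\<close> in a part \<open>p < r\<close>, and \<open>N = (n + 1)\<^sup>r\<close> matchings \<open>M\<^sub>a\<close> are indexed
  by vectors \<open>a \<in> {0..n}\<^sup>r\<close>. Each \<open>M\<^sub>a\<close> has two special edges: the first passes through
  \<open>x\<^sub>i(a\<^sub>i)\<close> in part \<open>i\<close>, the second through \<open>y\<^sub>i(a\<^sub>i)\<close> in part \<open>i + 1\<close>, for all \<open>i\<close>. The remaining
  \<open>x\<^sub>i(k)\<close> and \<open>y\<^sub>i(k)\<close>, \<open>k \<noteq> a\<^sub>i\<close>, lie pairwise in common edges whose vertices in the other parts
  are \<open>z\<^sub>i(0), \<dots>, z\<^sub>i(n - 1)\<close>. A rainbow matching of size \<open>t\<close> covers every vertex. Since only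
  the \<open>n\<close> edges through the \<open>z\<^sub>i(j)\<close> can cover pairs \<open>x\<^sub>i(k), y\<^sub>i(k)\<close>, exactly one index \<open>k\<close> is
  left over for each \<open>i\<close>. So the rainbow matching has exactly one special edge of each kind, and
  both belong to the same vector \<open>a\<close>, which contradicts the distinctness of the indices.
\<close>

section \<open>Construction of the matchings\<close>

text \<open>The members of block \<open>i\<close> serve both as edge numbers and as slots: they
  number the ordinary edges for index \<open>i\<close>, and in parts other than \<open>i\<close> and
  its cyclic successor they are the slots of \<open>z_i\<close>.\<close>

definition block :: "nat \<Rightarrow> nat \<Rightarrow> nat set" where
  "block n i = {i * n..<i * n + n}"

text \<open>A cyclic shift of \<open>s, b + a, \<dots>, b + n - 1\<close> that fixes everything else. The slots of
  \<open>x(0), \<dots>, x(n)\<close> are \<open>b, \<dots>, b + n - 1, s\<close>; position \<open>s\<close> stands for the special edge.\<close>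

definition slide :: "nat \<Rightarrow> nat \<Rightarrow> nat \<Rightarrow> nat \<Rightarrow> nat \<Rightarrow> nat" where
  "slide b n a s q =
    (if q = s then (if a < n then b + a else s)
     else if b + a \<le> q \<and> q < b + n then (if q + 1 < b + n then q + 1 else s)
     else q)"

definition prev_part :: "nat \<Rightarrow> nat \<Rightarrow> nat" where
  "prev_part r p = (if p = 0 then r - 1 else p - 1)"

definition next_part :: "nat \<Rightarrow> nat \<Rightarrow> nat" where
  "next_part r p = (if Suc p = r then 0 else Suc p)"

text \<open>The edge number \<open>q\<close> of the matching \<open>M\<^sub>a\<close> meets part \<open>p\<close> in this slot. The special edges are
  the numbers \<open>r * n\<close> and \<open>r * n + 1\<close>; larger numbers are padding shared by all matchings.\<close>

definition slot :: "nat \<Rightarrow> nat \<Rightarrow> (nat \<Rightarrow> nat) \<Rightarrow> nat \<Rightarrow> nat \<Rightarrow> nat" where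
  "slot r n a p q =
    slide (p * n) n (a p) (r * n)
      (slide (prev_part r p * n) n (a (prev_part r p)) (r * n + 1) q)"

text \<open>Slot \<open>v\<close> of part \<open>p\<close> is coded as \<open>v * r + p\<close>, so
  that the parts are residue classes modulo \<open>r\<close>.\<close>

definition edge :: "nat \<Rightarrow> (nat \<Rightarrow> nat) \<Rightarrow> nat set" where
  "edge r s = (\<lambda>p. s p * r + p) ` {..<r}"

definition slot_matching :: "nat \<Rightarrow> nat \<Rightarrow> nat \<Rightarrow> (nat \<Rightarrow> nat) \<Rightarrow> nat set set" where
  "slot_matching r n t a = (\<lambda>q. edge r (\<lambda>p. slot r n a p q)) ` {..<t}"

section \<open>Slides and blocks\<close>

lemma inj_slide:
  assumes "s \<notin> {b..<b + n}"
  shows "inj (slide b n a s)"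
  using assms by (intro injI) (auto simp: slide_def split: if_splits)

lemma slide_in:
  "q \<in> insert s {b..<b + n} \<Longrightarrow> slide b n a s q \<in> insert s {b..<b + n}"
  by (auto simp: slide_def)

lemma slide_out: "q \<notin> insert s {b..<b + n} \<Longrightarrow> slide b n a s q = q"
  by (auto simp: slide_def)

text \<open>The slots of \<open>x(k)\<close> and \<open>y(k)\<close> differ only for
  \<open>k = n\<close>, so an ordinary edge meets both families in the same index.\<close>

lemma slide_change_target:
  assumes "q \<in> {b..<b + n}" "s \<notin> {b..<b + n}" "s' \<notin> {b..<b + n}"
  shows "slide b n a s' q = (if slide b n a s q = s then s' else slide b n a s q)"
  using assms by (auto simp: slide_def)

lemma block_less:
  assumes "i < r"
  shows "block n i \<subseteq> {..<r * n}"
proof -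
  have "Suc i * n \<le> r * n" using assms by (intro mult_le_mono1) simp
  then show ?thesis by (auto simp: block_def)
qed

lemma block_disjoint:
  assumes "q \<in> block n i" "q \<in> block n j"
  shows "i = j"
proof (rule ccontr)
  assume "i \<noteq> j"
  then consider "i < j" | "j < i" by linarith
  then show False
  proof cases
    case 1 then show False using block_less[OF 1] assms by (fastforce simp: block_def)
  next
    case 2 then show False using block_less[OF 2] assms by (fastforce simp: block_def)
  qed
qed

lemma prev_part_less: "p < r \<Longrightarrow> prev_part r p < r"
  by (auto simp: prev_part_def)

lemma prev_part_neq: "p < r \<Longrightarrow> 2 \<le> r \<Longrightarrow> prev_part r p \<noteq> p"
  by (auto simp: prev_part_def)

lemma next_part_less: "p < r \<Longrightarrow> next_part r p < r"
  by (auto simp: next_part_def)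

lemma prev_next_part: "p < r \<Longrightarrow> prev_part r (next_part r p) = p"
  by (auto simp: prev_part_def next_part_def)

section \<open>Slots met by an edge in a fixed part\<close>

context
  fixes r n :: nat
  assumes r: "2 \<le> r"
begin

lemma inj_slot:
  assumes "p < r"
  shows "inj (slot r n a p)"
proof -
  have "inj (slide (p * n) n (a p) (r * n))"
    using mult_le_mono1[of "Suc p" r n] assms by (intro inj_slide) auto
  moreover have "inj (slide (prev_part r p * n) n (a (prev_part r p)) (r * n + 1))"
    using mult_le_mono1[of "Suc (prev_part r p)" r n] prev_part_less[OF assms]
    by (intro inj_slide) auto
  ultimately have "inj (slide (p * n) n (a p) (r * n) \<circ>
      slide (prev_part r p * n) n (a (prev_part r p)) (r * n + 1))"
    by (rule inj_compose)
  then show ?thesis by (simp add: slot_def[abs_def] comp_def)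
qed

text \<open>Blocks are disjoint and cyclic neighbours differ, so at most one of the two slides in
  \<open>slot\<close> moves a given number.\<close>

lemma first_not_second:
  assumes "p < r" "q \<in> insert (r * n) (block n p)"
  shows "q \<notin> insert (r * n + 1) (block n (prev_part r p))"
  using assms block_less[OF assms(1), of n] block_less[OF prev_part_less[OF assms(1)], of n]
    block_disjoint[of q n p "prev_part r p"] prev_part_neq[OF assms(1) r] by auto

lemma slot_first:
  assumes "p < r" "q \<in> insert (r * n) (block n p)"
  shows "slot r n a p q = slide (p * n) n (a p) (r * n) q"
  using first_not_second[OF assms] by (simp add: slot_def slide_out block_def)

lemma slot_second:
  assumes "p < r" "q \<in> insert (r * n + 1) (block n (prev_part r p))"
  shows "slot r n a p q = slide (prev_part r p * n) n (a (prev_part r p)) (r * n + 1) q"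
proof -
  have "slide (prev_part r p * n) n (a (prev_part r p)) (r * n + 1) q
      \<in> insert (r * n + 1) (block n (prev_part r p))"
    using assms slide_in unfolding block_def by blast
  then have "slide (prev_part r p * n) n (a (prev_part r p)) (r * n + 1) q
      \<notin> insert (r * n) (block n p)"
    using first_not_second[OF assms(1)] by blast
  then show ?thesis by (simp add: slot_def slide_out block_def)
qed

lemma slot_other:
  assumes "q \<notin> insert (r * n) (block n p)" "q \<notin> insert (r * n + 1) (block n (prev_part r p))"
  shows "slot r n a p q = q"
  using assms by (simp add: slot_def slide_out block_def)

text \<open>Each slide preserves its own set, and the two sets are disjoint. So the slot reveals,
  whatever \<open>a\<close> is, whether the edge number lies in the set; this allows counting across
  different matchings.\<close>

lemma slot_first_iff:
  assumes "p < r"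
  shows "slot r n a p q \<in> insert (r * n) (block n p) \<longleftrightarrow> q \<in> insert (r * n) (block n p)"
proof
  assume L: "slot r n a p q \<in> insert (r * n) (block n p)"
  show "q \<in> insert (r * n) (block n p)"
  proof (rule ccontr)
    assume q: "q \<notin> insert (r * n) (block n p)"
    show False
    proof (cases "q \<in> insert (r * n + 1) (block n (prev_part r p))")
      case True
      then have "slot r n a p q \<in> insert (r * n + 1) (block n (prev_part r p))"
        unfolding slot_second[OF assms True] using slide_in unfolding block_def by blast
      then show False using first_not_second[OF assms L] by blast
    next
      case False
      then show False using slot_other[OF q False] L q by simp
    qed
  qed
next
  assume q: "q \<in> insert (r * n) (block n p)"
  then show "slot r n a p q \<in> insert (r * n) (block n p)"
    unfolding slot_first[OF assms q] using slide_in unfolding block_def by blast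
qed

lemma slot_second_iff:
  assumes "p < r"
  shows "slot r n a p q \<in> insert (r * n + 1) (block n (prev_part r p))
    \<longleftrightarrow> q \<in> insert (r * n + 1) (block n (prev_part r p))" (is "?L \<longleftrightarrow> ?R")
proof
  assume ?R
  then show ?L
    unfolding slot_second[OF assms \<open>?R\<close>] using slide_in unfolding block_def by blast
next
  assume ?L
  then have "q \<notin> insert (r * n) (block n p)"
    using first_not_second[OF assms] slot_first_iff[OF assms] by blast
  then show ?R using slot_other \<open>?L\<close> by metis
qed

lemma slot_other_iff:
  assumes "p < r" "W \<inter> insert (r * n) (block n p) = {}"
    "W \<inter> insert (r * n + 1) (block n (prev_part r p)) = {}"
  shows "slot r n a p q \<in> W \<longleftrightarrow> q \<in> W"
proof (cases "q \<in> insert (r * n) (block n p) \<or> q \<in> insert (r * n + 1) (block n (prev_part r p))")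
  case True
  then have "slot r n a p q \<in> insert (r * n) (block n p)
      \<or> slot r n a p q \<in> insert (r * n + 1) (block n (prev_part r p))"
    using slot_first_iff[OF assms(1)] slot_second_iff[OF assms(1)] by blast
  with True assms show ?thesis by blast
next
  case False
  then show ?thesis using slot_other by simp
qed

lemma slot_less:
  assumes "p < r" "r * n + 2 \<le> t" "q < t"
  shows "slot r n a p q < t"
proof -
  have sub: "insert (r * n) (block n p) \<subseteq> {..<t}"
    "insert (r * n + 1) (block n (prev_part r p)) \<subseteq> {..<t}"
    using block_less[OF assms(1), of n] block_less[OF prev_part_less[OF assms(1)], of n] assms
    by fastforce+
  then show ?thesis
    using slot_first_iff[OF assms(1), of a q] slot_second_iff[OF assms(1), of a q]
      slot_other[of q p a] assms(3) by (metis lessThan_iff subsetD)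
qed

end

section \<open>Vertices as numbers, and the partition\<close>

lemma mem_edge_iff:
  assumes "p < r"
  shows "v * r + p \<in> edge r s \<longleftrightarrow> v = s p"
proof
  assume "v * r + p \<in> edge r s"
  then obtain p' where p': "p' < r" "v * r + p = s p' * r + p'" by (auto simp: edge_def)
  from p'(2) have "(v * r + p) mod r = (s p' * r + p') mod r"
    and "(v * r + p) div r = (s p' * r + p') div r" by simp_all
  with assms p'(1) show "v = s p" by simp
qed (use assms in \<open>auto simp: edge_def\<close>)

lemma edges_disjoint:
  assumes "\<And>p. p < r \<Longrightarrow> s p \<noteq> s' p"
  shows "edge r s \<inter> edge r s' = {}"
  using assms mem_edge_iff by (auto simp: edge_def[of r s])

lemma slots_neq:
  assumes "edge r s \<inter> edge r s' = {}" "p < r"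
  shows "s p \<noteq> s' p"
proof -
  have "s p * r + p \<in> edge r s" "s p * r + p \<notin> edge r s'"
    using assms mem_edge_iff[OF assms(2)] by auto
  then show ?thesis using mem_edge_iff[OF assms(2)] by auto
qed

lemma card_edge: "card (edge r s) = r"
proof -
  have "inj_on (\<lambda>p. s p * r + p) {..<r}"
  proof (rule inj_onI)
    fix x y assume "x \<in> {..<r}" "y \<in> {..<r}" "s x * r + x = s y * r + y"
    then have "(s x * r + x) mod r = (s y * r + y) mod r" "x < r" "y < r" by simp_all
    then show "x = y" by simp
  qed
  then show ?thesis by (simp add: edge_def card_image)
qed

lemma edge_vertices:
  assumes "\<And>p. p < r \<Longrightarrow> s p < t"
  shows "edge r s \<subseteq> {..<t * r}"
proof
  fix v assume "v \<in> edge r s"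
  then obtain p where p: "p < r" "v = s p * r + p" by (auto simp: edge_def)
  then have "v < Suc (s p) * r" by simp
  also have "\<dots> \<le> t * r" using assms[OF p(1)] by (intro mult_le_mono1) simp
  finally show "v \<in> {..<t * r}" by simp
qed

lemma partite_edges:
  assumes "0 < r" "\<And>e. e \<in> E \<Longrightarrow> \<exists>s. e = edge r s \<and> (\<forall>p<r. s p < t)"
  shows "partite r {..<t * r} E"
  unfolding partite_def
proof (intro exI conjI ballI)
  \<comment> \<open>\<open>partite\<close> numbers its parts from 1, hence the shift to the residue
    \<open>i - 1\<close>.\<close>
  let ?P = "\<lambda>i. {v. v < t * r \<and> v mod r = i - 1}"
  show "disjoint_family_on ?P {1..r}" by (auto simp: disjoint_family_on_def)
  show "(\<Union>i\<in>{1..r}. ?P i) = {..<t * r}"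
  proof (intro equalityI subsetI)
    fix v assume "v \<in> {..<t * r}"
    then show "v \<in> (\<Union>i\<in>{1..r}. ?P i)"
      using assms(1) by (intro UN_I[of "v mod r + 1"]) (auto simp: Suc_le_eq)
  qed auto
  fix e i assume "e \<in> E" and i: "i \<in> {1..r}"
  then obtain s where s: "e = edge r s" "\<And>p. p < r \<Longrightarrow> s p < t" using assms(2) by blast
  have "e \<inter> ?P i = {s (i - 1) * r + (i - 1)}"
  proof (intro equalityI subsetI)
    fix v assume "v \<in> e \<inter> ?P i"
    then show "v \<in> {s (i - 1) * r + (i - 1)}" unfolding s(1) edge_def by auto
  next
    have "i - 1 < r" using i by auto
    then have "s (i - 1) * r + (i - 1) \<in> e" "(s (i - 1) * r + (i - 1)) mod r = i - 1"
      unfolding s(1) edge_def by auto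
    moreover have "e \<subseteq> {..<t * r}" unfolding s(1) by (rule edge_vertices[OF s(2)])
    moreover fix v assume "v \<in> {s (i - 1) * r + (i - 1)}"
    ultimately show "v \<in> e \<inter> ?P i" by auto
  qed
  then show "card (e \<inter> ?P i) = 1" by simp
qed

section \<open>Counting in a perfect rainbow matching\<close>

text \<open>Equal cardinalities make \<open>\<tau>\<close> a bijection onto \<open>T\<close>, so
  each element of \<open>W\<close> is hit exactly once.\<close>

lemma card_preimage_invariant:
  fixes \<tau> :: "'a \<Rightarrow> 'b"
  assumes "finite K" "finite T" "card K = card T" "inj_on \<tau> K" "\<tau> ` K \<subseteq> T" "W \<subseteq> T"
    and "\<And>k. k \<in> K \<Longrightarrow> \<tau> k \<in> W \<longleftrightarrow> q k \<in> W"
  shows "card {k \<in> K. q k \<in> W} = card W"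
proof -
  have "\<tau> ` K = T" using assms by (intro card_subset_eq) (simp_all add: card_image)
  then have "\<tau> ` {k \<in> K. q k \<in> W} = W" using assms by auto
  moreover have "inj_on \<tau> {k \<in> K. q k \<in> W}" using assms(4) by (rule inj_on_subset) auto
  ultimately show ?thesis by (metis card_image)
qed

text \<open>\<open>K\<close> indexes the edges of a supposed rainbow matching; \<open>inj\<close>
  expresses their disjointness part by part.\<close>

lemma same_parameters:
  fixes A :: "nat \<Rightarrow> nat \<Rightarrow> nat"
  assumes r: "3 \<le> r" and t: "r * n + 2 \<le> t"
    and A: "\<And>k p. k \<in> K \<Longrightarrow> p < r \<Longrightarrow> A k p \<le> n"
    and K: "finite K" "card K = t"
    and q: "\<And>k. k \<in> K \<Longrightarrow> q k < t"
    and inj: "\<And>p. p < r \<Longrightarrow> inj_on (\<lambda>k. slot r n (A k) p (q k)) K"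
  shows "\<exists>k\<in>K. \<exists>l\<in>K. k \<noteq> l \<and> (\<forall>p<r. A k p = A l p)"
proof -
  have r2: "2 \<le> r" using r by simp
  define \<tau> where "\<tau> p k = slot r n (A k) p (q k)" for p k
  have \<tau>_inj: "inj_on (\<tau> p) K" if "p < r" for p
    using inj[OF that] by (simp add: \<tau>_def[abs_def])
  have \<tau>_sub: "\<tau> p ` K \<subseteq> {..<t}" if "p < r" for p
    using slot_less[OF r2 that t] q by (auto simp: \<tau>_def)
  have \<tau>_img: "\<tau> p ` K = {..<t}" if "p < r" for p
    using \<tau>_inj[OF that] \<tau>_sub[OF that] K by (intro card_subset_eq) (auto simp: card_image)
  have count: "card {k \<in> K. q k \<in> W} = card W"
    if "p < r" "W \<subseteq> {..<t}" "\<And>k. k \<in> K \<Longrightarrow> \<tau> p k \<in> W \<longleftrightarrow> q k \<in> W" for p W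
    using K \<tau>_inj[OF that(1)] \<tau>_sub[OF that(1)] that(2,3)
    by (intro card_preimage_invariant[of K "{..<t}" "\<tau> p"]) auto
  have r0: "0 < r" and r1: "Suc 0 < r" using r by auto
  have Bt: "block n i \<subseteq> {..<t}" if "i < r" for i
    using block_less[OF that, of n] t by auto
  have B0: "card {k \<in> K. q k \<in> block n 0} = n"
  proof -
    \<comment> \<open>Part 2 carries only the families \<open>x_2\<close> and \<open>y_1\<close>, so
      both slides fix block 0 there: these are the slots of \<open>z_0\<close>. This is where a
      third part is needed.\<close>
    have "2 < r" using r by simp
    have "block n 0 \<inter> insert (r * n) (block n 2) = {}"
      "block n 0 \<inter> insert (r * n + 1) (block n (prev_part r 2)) = {}"
      using block_less[OF r0, of n] block_disjoint by (fastforce simp: prev_part_def)+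
    then have "card {k \<in> K. q k \<in> block n 0} = card (block n 0)"
      using slot_other_iff[OF r2 \<open>2 < r\<close>] Bt[OF r0]
      by (intro count[of 2]) (auto simp: \<tau>_def \<open>2 < r\<close>)
    then show ?thesis by (simp add: block_def)
  qed
  \<comment> \<open>Block 0 together with \<open>s\<close> has \<open>n + 1\<close> elements, and
    \<open>B0\<close> leaves exactly one for the special edge.\<close>
  have one: "card {k \<in> K. q k = s} = 1"
    if "s \<notin> block n 0" "card {k \<in> K. q k \<in> insert s (block n 0)} = card (insert s (block n 0))" for s
  proof -
    have "{k \<in> K. q k \<in> insert s (block n 0)} = {k \<in> K. q k = s} \<union> {k \<in> K. q k \<in> block n 0}"
      by auto
    moreover have "card ({k \<in> K. q k = s} \<union> {k \<in> K. q k \<in> block n 0})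
        = card {k \<in> K. q k = s} + card {k \<in> K. q k \<in> block n 0}"
      using K(1) that(1) by (intro card_Un_disjoint) auto
    ultimately show ?thesis using that B0 by (simp add: block_def)
  qed
  have "card {k \<in> K. q k = r * n} = 1"
  proof (rule one)
    show "r * n \<notin> block n 0" using block_less[OF r0] by fastforce
    show "card {k \<in> K. q k \<in> insert (r * n) (block n 0)} = card (insert (r * n) (block n 0))"
      using slot_first_iff[OF r2 r0] Bt[OF r0] t
      by (intro count[of 0]) (auto simp: \<tau>_def r0 simp del: insert_iff)
  qed
  then obtain f where f: "f \<in> K" "q f = r * n" by (auto simp: card_1_singleton_iff)
  \<comment> \<open>The family \<open>y_0\<close> lies in part 1, since
    \<open>prev_part r 1 = 0\<close>.\<close>
  have "card {k \<in> K. q k = r * n + 1} = 1"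
  proof (rule one)
    show "r * n + 1 \<notin> block n 0" using block_less[OF r0] by fastforce
    show "card {k \<in> K. q k \<in> insert (r * n + 1) (block n 0)} = card (insert (r * n + 1) (block n 0))"
      using slot_second_iff[OF r2 r1] Bt[OF r0] t r1
      by (intro count[of 1]) (auto simp: \<tau>_def prev_part_def simp del: insert_iff)
  qed
  then obtain g where g: "{k \<in> K. q k = r * n + 1} = {g}" by (auto simp: card_1_singleton_iff)
  have "A f i = A g i" if i: "i < r" for i
  proof -
    \<comment> \<open>\<open>h\<close> takes the slot of \<open>x_i(k)\<close> in part
      \<open>i\<close> to the slot of its partner \<open>y_i(k)\<close> in part
      \<open>i'\<close>.\<close>
    define h where "h v = (if v = r * n then r * n + 1 else v)" for v
    define i' where "i' = next_part r i"
    have i': "i' < r" "prev_part r i' = i" "i' \<noteq> i"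
      using next_part_less[OF i] prev_next_part[OF i] prev_part_neq[OF _ r2, of i'] i
      by (auto simp: i'_def)
    have notin: "r * n \<notin> block n i" "r * n + 1 \<notin> block n i" using block_less[OF i, of n] by auto
    have \<tau>i: "\<tau> i k \<in> insert (r * n) (block n i) \<longleftrightarrow> q k \<in> insert (r * n) (block n i)" for k
      unfolding \<tau>_def by (rule slot_first_iff[OF r2 i])
    have \<tau>i': "\<tau> i' k \<in> insert (r * n + 1) (block n i)
        \<longleftrightarrow> q k \<in> insert (r * n + 1) (block n i)" for k
      using slot_second_iff[OF r2 i'(1)] by (simp only: \<tau>_def i'(2))
    have \<tau>f: "\<tau> i f \<in> insert (r * n) (block n i)" using \<tau>i f by simp
    then have hf: "h (\<tau> i f) \<in> insert (r * n + 1) (block n i)" by (auto simp: h_def)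
    then have "h (\<tau> i f) < t" using Bt[OF i] t by auto
    \<comment> \<open>All slots are covered, so some edge contains the partner of the
      \<open>x_i\<close> vertex of \<open>f\<close>.\<close>
    then obtain k where k: "k \<in> K" "\<tau> i' k = h (\<tau> i f)"
      using \<tau>_img[OF i'(1)] by (metis imageE lessThan_iff)
    have "q k \<in> insert (r * n + 1) (block n i)" using \<tau>i' k(2) hf by metis
    \<comment> \<open>An ordinary edge through the partner would also contain the \<open>x_i\<close>
      vertex of \<open>f\<close>, hence be \<open>f\<close> itself, which is special.\<close>
    moreover have "q k \<notin> block n i"
    proof
      assume qk: "q k \<in> block n i"
      have "\<tau> i' k = slide (i * n) n (A k i) (r * n + 1) (q k)"
        using slot_second[OF r2 i'(1)] qk i'(2) by (simp add: \<tau>_def)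
      also have "\<dots> = h (slide (i * n) n (A k i) (r * n) (q k))"
        unfolding h_def using qk notin unfolding block_def by (rule slide_change_target)
      also have "\<dots> = h (\<tau> i k)"
        using slot_first[OF r2 i] qk by (simp add: \<tau>_def)
      finally have "h (\<tau> i k) = h (\<tau> i f)" using k(2) by simp
      moreover have "\<tau> i k \<in> insert (r * n) (block n i)" using \<tau>i qk by simp
      ultimately have "\<tau> i k = \<tau> i f"
        using \<tau>f notin by (auto simp: h_def split: if_splits)
      then have "k = f" using \<tau>_inj[OF i] k(1) f(1) by (simp add: inj_on_eq_iff)
      then show False using qk f(2) notin by simp
    qed
    ultimately have qk: "q k = r * n + 1" by simp
    then have "k = g" using g k(1) by blast
    \<comment> \<open>The slot of a special edge determines its entry of the vector; entry
      \<open>n\<close> corresponds to the extra slot.\<close>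
    have "\<tau> i f = slide (i * n) n (A f i) (r * n) (r * n)"
      using slot_first[OF r2 i] f(2) by (simp add: \<tau>_def)
    moreover have "\<tau> i' g = slide (i * n) n (A g i) (r * n + 1) (r * n + 1)"
      using slot_second[OF r2 i'(1)] qk i'(2) \<open>k = g\<close> by (simp add: \<tau>_def)
    ultimately have "slide (i * n) n (A g i) (r * n + 1) (r * n + 1)
        = h (slide (i * n) n (A f i) (r * n) (r * n))"
      using k(2) \<open>k = g\<close> by simp
    moreover have "A f i \<le> n" "A g i \<le> n" using A i f(1) k(1) \<open>k = g\<close> by auto
    moreover have "i * n + a \<noteq> r * n \<and> i * n + a \<noteq> r * n + 1" if "a < n" for a
      using notin block_less[OF i, of n] that unfolding block_def
      by (metis atLeastLessThan_iff le_add1 nat_add_left_cancel_less)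
    ultimately show ?thesis
      by (auto simp: slide_def h_def split: if_splits)
  qed
  moreover have "g \<in> K" "q g = r * n + 1" using g by auto
  moreover have "f \<noteq> g" using f(2) \<open>q g = r * n + 1\<close> by auto
  ultimately show ?thesis using f(1) by blast
qed

section \<open>Assembly of the counterexample\<close>

lemma slot_matching_disjoint:
  assumes "2 \<le> r"
  shows "disjoint (slot_matching r n t a)" "card (slot_matching r n t a) = t"
proof -
  have dis: "edge r (\<lambda>p. slot r n a p q) \<inter> edge r (\<lambda>p. slot r n a p q') = {}" if "q \<noteq> q'" for q q'
  proof (rule edges_disjoint)
    fix p assume "p < r"
    then show "slot r n a p q \<noteq> slot r n a p q'"
      using inj_slot[OF assms, THEN injD] that by metis
  qed
  show "disjoint (slot_matching r n t a)"
    unfolding slot_matching_def by (rule disjointI) (elim imageE, metis dis)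
  have "edge r s \<noteq> {}" for s using card_edge[of r s] assms by auto
  then have "inj_on (\<lambda>q. edge r (\<lambda>p. slot r n a p q)) {..<t}"
    by (intro inj_onI) (metis dis Int_absorb)
  then show "card (slot_matching r n t a) = t"
    by (simp add: slot_matching_def card_image)
qed

theorem theorem3p1:
  fixes r t N :: nat
  assumes "r \<ge> 3" and "t \<ge> 2 * r" and "N = (t div r - 1) ^ r"
  shows "\<exists>(V :: nat set) (E :: nat set set) (M :: nat \<Rightarrow> nat set set).
    hypergraph V E \<and> uniform r E \<and> partite r V E \<and> card V = t * r \<and>
    (\<forall>j\<in>{1..N}. matching E (M j) \<and> card (M j) = t) \<and>
    \<not> has_rainbow_matching N M t"
proof -
  \<comment> \<open>Entries range over \<open>{..n}\<close>, which has \<open>t div r - 1\<close>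
    elements; the remaining \<open>t - r * n\<close> edge numbers leave room for both special
    edges.\<close>
  define n where "n = t div r - 2"
  have r2: "2 \<le> r" using assms(1) by simp
  have "2 \<le> t div r"
    using assms(1,2) by (simp add: less_eq_div_iff_mult_less_eq)
  then have n: "t div r = n + 2" by (simp add: n_def)
  have "r * (n + 2) \<le> t" unfolding n[symmetric] by simp
  then have t: "r * n + 2 \<le> t" using assms(1) by (simp add: algebra_simps)
  have "card ({..<r} \<rightarrow>\<^sub>E {..n}) = N"
    by (simp add: card_PiE assms(3) n)
  then obtain b where b: "bij_betw b {1..N} ({..<r} \<rightarrow>\<^sub>E {..n})"
    using finite_same_card_bij[of "{1..N}" "{..<r} \<rightarrow>\<^sub>E {..n}"] by (auto simp: finite_PiE)
  define V where "V = {..<t * r}"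
  \<comment> \<open>The complete \<open>r\<close>-partite hypergraph contains all the
    matchings.\<close>
  define E where "E = {edge r s |s. \<forall>p<r. s p < t}"
  define M where "M j = slot_matching r n t (b j)" for j
  have "hypergraph V E" using edge_vertices by (auto simp: hypergraph_def V_def E_def)
  moreover have "uniform r E" by (auto simp: uniform_def E_def card_edge)
  moreover have "partite r V E"
    unfolding V_def using assms(1) by (intro partite_edges) (auto simp: E_def)
  moreover have "card V = t * r" by (simp add: V_def)
  moreover have "matching E (M j) \<and> card (M j) = t" for j
  proof -
    have "M j \<subseteq> E" using slot_less[OF r2 _ t] by (auto simp: M_def E_def slot_matching_def)
    then show ?thesis using slot_matching_disjoint[OF r2] by (simp add: matching_def M_def)
  qed
  moreover have "\<not> has_rainbow_matching N M t"
  proof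
    assume "has_rainbow_matching N M t"
    then obtain i e where i: "inj_on i {1..t}" "i ` {1..t} \<subseteq> {1..N}"
      and e: "\<And>k. k \<in> {1..t} \<Longrightarrow> e k \<in> M (i k)" "disjoint_family_on e {1..t}"
      unfolding has_rainbow_matching_def by blast
    have "\<forall>k\<in>{1..t}. \<exists>q<t. e k = edge r (\<lambda>p. slot r n (b (i k)) p q)"
      using e(1) unfolding M_def slot_matching_def by blast
    then obtain q where q: "\<And>k. k \<in> {1..t} \<Longrightarrow> q k < t"
      "\<And>k. k \<in> {1..t} \<Longrightarrow> e k = edge r (\<lambda>p. slot r n (b (i k)) p (q k))"
      by metis
    have bi: "b (i k) \<in> {..<r} \<rightarrow>\<^sub>E {..n}" if "k \<in> {1..t}" for k
      using bij_betwE[OF b] i(2) that by blast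
    have "\<exists>k\<in>{1..t}. \<exists>l\<in>{1..t}. k \<noteq> l \<and> (\<forall>p<r. b (i k) p = b (i l) p)"
    proof (rule same_parameters[OF assms(1) t, where q = q])
      fix p assume p: "p < r"
      show "inj_on (\<lambda>k. slot r n (b (i k)) p (q k)) {1..t}"
      proof (rule inj_onI, rule ccontr)
        fix k l assume kl: "k \<in> {1..t}" "l \<in> {1..t}" "k \<noteq> l"
          and eq: "slot r n (b (i k)) p (q k) = slot r n (b (i l)) p (q l)"
        have "e k \<inter> e l = {}" using e(2) kl by (auto simp: disjoint_family_on_def)
        then show False using slots_neq[OF _ p] q(2) kl eq by metis
      qed
    qed (use bi q(1) in \<open>auto simp: PiE_iff\<close>)
    then obtain k l where kl: "k \<in> {1..t}" "l \<in> {1..t}" "k \<noteq> l" "\<And>p. p < r \<Longrightarrow> b (i k) p = b (i l) p"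
      by blast
    \<comment> \<open>Extensionality turns agreement on \<open>{..<r}\<close> into equality of the
      vectors.\<close>
    have "b (i k) = b (i l)"
      using bi[OF kl(1)] bi[OF kl(2)] kl(4) by (intro PiE_ext) auto
    moreover have "i k \<in> {1..N}" "i l \<in> {1..N}" using i(2) kl(1,2) by blast+
    ultimately have "i k = i l" using bij_betw_imp_inj_on[OF b] by (blast dest: inj_onD)
    then show False using i(1) kl(1-3) by (blast dest: inj_onD)
  qed
  ultimately show ?thesis by blast
qed

end
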